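(* Let $n\geq 1$ and let $\Gamma$ be a finitely generated group which acts on the Euclidean space $\mathbb{R}^n$ by isometries. If there exists a bounded subset $F \subset \mathbb{R}^n$ such that $\bigcup_{\varphi \in \Gamma}\varphi(F)=\mathbb{R}^n$, then for any $o \in \mathbb{R}^n$, $$\limsup_{k \to \infty}\max_{\varphi\in\Gamma,\ |\varphi|_w=k}\frac{d(o,\varphi(o))}{k}>0.$$
   Context: $|\varphi|_w$ is the word norm of $\varphi\in\Gamma$ with respect to a fixed finite symmetric generating set $S$ of $\Gamma$ (closed under inverses), i.e. the length of a shortest word over $S$ representing $\varphi$. $d$ is the Euclidean distance. The action is not assumed to be properly discontinuous. *)

theory Defs
  imports "HOL-Analysis.Analysis" "HOL-Algebra.Group_Action" "HOL-Algebra.Generated_Groups"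
begin

definition word_prod :: "('a, 'b) monoid_scheme \<Rightarrow> 'a list \<Rightarrow> 'a"
  where "word_prod G ws = foldr (\<otimes>\<^bsub>G\<^esub>) ws \<one>\<^bsub>G\<^esub>"

definition symmetric_generating_set :: "('a, 'b) monoid_scheme \<Rightarrow> 'a set \<Rightarrow> bool"
  where "symmetric_generating_set G S \<longleftrightarrow>
    S \<subseteq> carrier G \<and> (\<forall>s\<in>S. inv\<^bsub>G\<^esub> s \<in> S) \<and> generate G S = carrier G"

(* Meaningful for elements that are products of words over S; for a symmetric
   generating set these are all elements of the carrier. *)
definition word_norm :: "('a, 'b) monoid_scheme \<Rightarrow> 'a set \<Rightarrow> 'a \<Rightarrow> nat"
  where "word_norm G S g =
    (LEAST k. \<exists>ws. set ws \<subseteq> S \<and> length ws = k \<and> word_prod G ws = g)"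

(* The action is a homomorphism from G into the bijections of the space; neither
   faithfulness nor proper discontinuity is required. *)
definition isometric_action ::
    "('a, 'b) monoid_scheme \<Rightarrow> ('a \<Rightarrow> 'm::metric_space \<Rightarrow> 'm) \<Rightarrow> bool"
  where "isometric_action G act \<longleftrightarrow>
    group_action G UNIV act \<and>
    (\<forall>g\<in>carrier G. \<forall>x y. dist (act g x) (act g y) = dist x y)"

end

theory Submission
  imports Defs
begin

text \<open>
  Some orbit point lies within a fixed distance \<open>R\<close> of every point. By compactness a finite set
  \<open>T\<close> of group elements suffices to come \<open>(R + 1)\<close>-close to every point of the ball of radius
  \<open>R + 2\<close> around \<open>p\<close>. Fix a unit vector \<open>u\<close>. Applying an isometry \<open>g\<close> of the group, one sees
  that from \<open>g p\<close> some step \<open>t \<in> T\<close> leads to within \<open>R + 1\<close> of \<open>g p + (R + 2) u\<close>, and thus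
  advances by at least 1 in direction \<open>u\<close>. Greedily, \<open>k\<close> steps advance by \<open>k\<close>, while the word
  norm grows at most linearly in \<open>k\<close>; it also tends to infinity, since the displacement is at
  most linear in the word norm.
\<close>

section \<open>Words and the word norm\<close>

lemma (in group) word_prod_closed:
  "set ws \<subseteq> carrier G \<Longrightarrow> word_prod G ws \<in> carrier G"
  by (induction ws) (auto simp: word_prod_def)

lemma (in group) word_prod_append:
  assumes "set us \<subseteq> carrier G" "set vs \<subseteq> carrier G"
  shows "word_prod G (us @ vs) = word_prod G us \<otimes> word_prod G vs"
  using assms(1)
proof (induction us)
  case Nil
  then show ?case
    using word_prod_closed[OF assms(2)] by (simp add: word_prod_def)
next
  case (Cons a us)
  then show ?case
    using word_prod_closed[of us] word_prod_closed[OF assms(2)]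
    by (simp add: word_prod_def m_assoc)
qed

lemma (in group) word_exists:
  assumes S: "symmetric_generating_set G S" and g: "g \<in> carrier G"
  shows "\<exists>ws. set ws \<subseteq> S \<and> word_prod G ws = g"
proof -
  have SG: "S \<subseteq> carrier G" and inv: "\<And>s. s \<in> S \<Longrightarrow> inv s \<in> S"
    using S by (auto simp: symmetric_generating_set_def)
  have letter: "\<exists>ws. set ws \<subseteq> S \<and> word_prod G ws = s" if "s \<in> S" for s
    using that SG by (intro exI[of _ "[s]"]) (auto simp: word_prod_def)
  have "g \<in> generate G S"
    using S g by (simp add: symmetric_generating_set_def)
  then show ?thesis
  proof induction
    case one
    show ?case by (intro exI[of _ "[]"]) (simp add: word_prod_def)
  next
    case (eng h1 h2)
    then obtain us vs where "set us \<subseteq> S" "word_prod G us = h1" "set vs \<subseteq> S" "word_prod G vs = h2"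
      by blast
    then show ?case
      using SG word_prod_append[of us vs] by (intro exI[of _ "us @ vs"]) auto
  \<comment> \<open>What remains are generators and inverses of generators; the latter are again
    letters because \<open>S\<close> is closed under inverses.\<close>
  qed (use letter inv in auto)
qed

lemma word_norm_le_length:
  "set ws \<subseteq> S \<Longrightarrow> word_norm G S (word_prod G ws) \<le> length ws"
  unfolding word_norm_def by (rule Least_le) blast

lemma (in group) word_norm_attained:
  assumes "symmetric_generating_set G S" "g \<in> carrier G"
  obtains ws where "set ws \<subseteq> S" "length ws = word_norm G S g" "word_prod G ws = g"
proof -
  have "\<exists>k ws. set ws \<subseteq> S \<and> length ws = k \<and> word_prod G ws = g"
    using word_exists[OF assms] by blast
  from LeastI_ex[OF this] show ?thesis
    using that unfolding word_norm_def by blast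
qed

lemma (in group) word_norm_mult:
  assumes S: "symmetric_generating_set G S" and "g \<in> carrier G" "h \<in> carrier G"
  shows "word_norm G S (g \<otimes> h) \<le> word_norm G S g + word_norm G S h"
proof -
  obtain us where us: "set us \<subseteq> S" "length us = word_norm G S g" "word_prod G us = g"
    using word_norm_attained[OF S assms(2)] .
  obtain vs where vs: "set vs \<subseteq> S" "length vs = word_norm G S h" "word_prod G vs = h"
    using word_norm_attained[OF S assms(3)] .
  have "S \<subseteq> carrier G"
    using S by (simp add: symmetric_generating_set_def)
  then have "word_prod G (us @ vs) = g \<otimes> h"
    using us vs word_prod_append[of us vs] by auto
  then show ?thesis
    using word_norm_le_length[of "us @ vs" S G] us vs by simp
qed

text \<open>There are only finitely many words of each length over a finite alphabet. This makes the
  maximum over a sphere a finite one.\<close>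

lemma (in group) finite_word_norm_sphere:
  assumes "symmetric_generating_set G S" "finite S"
  shows "finite {g \<in> carrier G. word_norm G S g = k}"
proof (rule finite_subset)
  show "{g \<in> carrier G. word_norm G S g = k} \<subseteq> word_prod G ` {ws. set ws \<subseteq> S \<and> length ws = k}"
  proof
    fix g assume g: "g \<in> {g \<in> carrier G. word_norm G S g = k}"
    then obtain ws where "set ws \<subseteq> S" "length ws = word_norm G S g" "word_prod G ws = g"
      using word_norm_attained[OF assms(1), of g] by blast
    then show "g \<in> word_prod G ` {ws. set ws \<subseteq> S \<and> length ws = k}"
      using g by blast
  qed
  show "finite (word_prod G ` {ws. set ws \<subseteq> S \<and> length ws = k})"
    using finite_lists_length_eq[OF assms(2)] by simp
qed

section \<open>Isometric actions and displacement\<close>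

lemma isometric_action_mult:
  assumes "isometric_action G act" "g \<in> carrier G" "h \<in> carrier G"
  shows "act (g \<otimes>\<^bsub>G\<^esub> h) x = act g (act h x)"
  using assms group_action.composition_rule[of G UNIV act x g h]
  by (simp add: isometric_action_def)

lemma isometric_action_one:
  assumes "isometric_action G act"
  shows "act \<one>\<^bsub>G\<^esub> x = x"
proof -
  have "(\<lambda>x\<in>UNIV. x) = act \<one>\<^bsub>G\<^esub>"
    using assms group_action.id_eq_one[of G UNIV act] by (simp add: isometric_action_def)
  then show ?thesis by (metis restrict_UNIV)
qed

lemma isometric_action_dist:
  "isometric_action G act \<Longrightarrow> g \<in> carrier G \<Longrightarrow> dist (act g x) (act g y) = dist x y"
  by (simp add: isometric_action_def)

lemma isometric_action_surj:
  "isometric_action G act \<Longrightarrow> g \<in> carrier G \<Longrightarrow> surj (act g)"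
  using group_action.surj_prop[of G UNIV act g] by (simp add: isometric_action_def)

text \<open>Peeling off the first letter \<open>s\<close> of a shortest word costs at most
  \<open>dist p (act s p)\<close>, since \<open>act s\<close> preserves the remaining distance.
  Summing over \<open>S\<close> bounds all these costs at once, even if \<open>S\<close> is
  empty.\<close>

lemma (in group) displacement_le_word_norm:
  assumes S: "symmetric_generating_set G S" "finite S"
    and act: "isometric_action G act" and g: "g \<in> carrier G"
  shows "dist p (act g p) \<le> (\<Sum>s\<in>S. dist p (act s p)) * real (word_norm G S g)"
proof -
  define C where "C = (\<Sum>s\<in>S. dist p (act s p))"
  have SG: "S \<subseteq> carrier G"
    using S by (simp add: symmetric_generating_set_def)
  have "dist p (act (word_prod G ws) p) \<le> C * real (length ws)" if "set ws \<subseteq> S" for ws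
    using that
  proof (induction ws)
    case Nil
    then show ?case by (simp add: word_prod_def isometric_action_one[OF act])
  next
    case (Cons s ws)
    have s: "s \<in> S" "s \<in> carrier G" and ws: "word_prod G ws \<in> carrier G"
      using Cons.prems SG word_prod_closed[of ws] by auto
    have "act (word_prod G (s # ws)) p = act s (act (word_prod G ws) p)"
      using isometric_action_mult[OF act s(2) ws] by (simp add: word_prod_def)
    then have "dist p (act (word_prod G (s # ws)) p)
        \<le> dist p (act s p) + dist (act s p) (act s (act (word_prod G ws) p))"
      by (metis dist_triangle)
    also have "dist (act s p) (act s (act (word_prod G ws) p)) = dist p (act (word_prod G ws) p)"
      by (rule isometric_action_dist[OF act s(2)])
    also have "dist p (act s p) \<le> C"
      unfolding C_def using s S by (intro member_le_sum) auto
    finally show ?case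
      using Cons by (simp add: algebra_simps)
  qed
  then show ?thesis
    using word_norm_attained[OF S(1) g] unfolding C_def by metis
qed

section \<open>Coarse density of the orbit\<close>

lemma isometric_action_coarsely_dense_orbit:
  assumes act: "isometric_action G act" and "bounded F"
    and cover: "(\<Union>g\<in>carrier G. act g ` F) = UNIV"
  obtains R where "\<And>x. \<exists>g\<in>carrier G. dist (act g p) x \<le> R"
proof -
  obtain R where R: "\<And>y. y \<in> F \<Longrightarrow> dist p y \<le> R"
    using \<open>bounded F\<close> bounded_any_center by metis
  have "\<exists>g\<in>carrier G. dist (act g p) x \<le> R" for x
  proof -
    obtain g y where g: "g \<in> carrier G" "y \<in> F" "x = act g y"
      using cover by blast
    then show ?thesis
      using R isometric_action_dist[OF act g(1), of p y] by metis
  qed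
  then show ?thesis using that by blast
qed

text \<open>An orbit may accumulate, so finiteness has to come from total boundedness of
  \<open>K\<close>: one index is chosen for each centre of a finite \<open>e\<close>-net, at the
  price of \<open>e\<close> in the distance.\<close>

lemma coarsely_dense_finite_subset:
  fixes K :: "'a::metric_space set"
  assumes "compact K" and dense: "\<And>x. \<exists>g\<in>A. dist (f g) x \<le> R" and "e > 0"
  obtains T where "finite T" "T \<subseteq> A" "\<And>x. x \<in> K \<Longrightarrow> \<exists>t\<in>T. dist (f t) x \<le> R + e"
proof -
  obtain N where N: "finite N" "K \<subseteq> (\<Union>x\<in>N. ball x e)"
    using \<open>compact K\<close> \<open>e > 0\<close> unfolding compact_eq_totally_bounded by metis
  obtain c where c: "\<And>x. c x \<in> A" "\<And>x. dist (f (c x)) x \<le> R"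
    using dense by metis
  have "\<exists>t\<in>c ` N. dist (f t) x \<le> R + e" if "x \<in> K" for x
  proof -
    obtain z where z: "z \<in> N" "dist z x < e"
      using N \<open>x \<in> K\<close> by auto
    have "dist (f (c z)) x \<le> dist (f (c z)) z + dist z x"
      by (rule dist_triangle)
    also have "\<dots> \<le> R + e"
      using c(2)[of z] z by simp
    finally show ?thesis using z by blast
  qed
  then show ?thesis
    using that[of "c ` N"] N c by blast
qed

lemma (in group) linear_displacement:
  fixes act :: "'a \<Rightarrow> 'v::euclidean_space \<Rightarrow> 'v"
  assumes S: "symmetric_generating_set G S" and act: "isometric_action G act"
    and F: "bounded F" "(\<Union>g\<in>carrier G. act g ` F) = UNIV"
  obtains m where "\<And>k. \<exists>g\<in>carrier G. real k \<le> dist p (act g p) \<and> word_norm G S g \<le> m * k"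
proof -
  obtain R where R: "\<And>x. \<exists>g\<in>carrier G. dist (act g p) x \<le> R"
    using isometric_action_coarsely_dense_orbit[OF act F] by blast
  have "R \<ge> 0"
    using R zero_le_dist order_trans by metis
  \<comment> \<open>A target at distance \<open>R + 2\<close>, hit with error at most
    \<open>R + 1\<close>, leaves a gain of at least 1.\<close>
  obtain T where T: "finite T" "T \<subseteq> carrier G"
    "\<And>x. x \<in> cball p (R + 2) \<Longrightarrow> \<exists>t\<in>T. dist (act t p) x \<le> R + 1"
    using coarsely_dense_finite_subset[OF compact_cball R zero_less_one] by metis
  define m where "m = (\<Sum>t\<in>T. word_norm G S t)"
  have m: "word_norm G S t \<le> m" if "t \<in> T" for t
    unfolding m_def using T that by (intro member_le_sum) auto
  obtain u :: 'v where u: "norm u = 1"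
    using vector_choose_size[of 1] by auto
  have step: "\<exists>t\<in>T. 1 \<le> u \<bullet> (act (g \<otimes> t) p - act g p)" if g: "g \<in> carrier G" for g
  proof -
    define y where "y = act g p + (R + 2) *\<^sub>R u"
    \<comment> \<open>Pulling the target back by \<open>g\<close> lands in the fixed ball around
      \<open>p\<close>, so the same finite \<open>T\<close> serves every \<open>g\<close>. This is
      why \<open>t\<close> is multiplied on the right.\<close>
    obtain w where w: "act g w = y"
      using isometric_action_surj[OF act g] by (metis surjD)
    have "dist p w = dist (act g p) y"
      using isometric_action_dist[OF act g, of p w] w by simp
    also have "\<dots> = R + 2"
      using u \<open>R \<ge> 0\<close> by (simp add: y_def dist_norm)
    finally obtain t where t: "t \<in> T" "dist (act t p) w \<le> R + 1"
      using T(3)[of w] by auto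
    have gt: "act (g \<otimes> t) p = act g (act t p)"
      using t T isometric_action_mult[OF act g] by blast
    then have "norm (y - act (g \<otimes> t) p) \<le> R + 1"
      using t w isometric_action_dist[OF act g, of "act t p" w]
      by (simp add: dist_norm norm_minus_commute)
    then have "u \<bullet> (y - act (g \<otimes> t) p) \<le> R + 1"
      using norm_cauchy_schwarz[of u "y - act (g \<otimes> t) p"] u by simp
    moreover have "u \<bullet> u = 1"
      using u by (simp add: dot_square_norm)
    ultimately have "1 \<le> u \<bullet> (act (g \<otimes> t) p - act g p)"
      by (simp add: y_def inner_diff_right inner_add_right)
    then show ?thesis using t by blast
  qed
  \<comment> \<open>Progress is measured along \<open>u\<close> because these gains add up over the
    steps, which distances from \<open>p\<close> need not do.\<close>
  have "\<exists>g\<in>carrier G. real k \<le> u \<bullet> (act g p - p) \<and> word_norm G S g \<le> m * k" for k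
  proof (induction k)
    case 0
    have "word_norm G S \<one> \<le> 0"
      using word_norm_le_length[of "[]" S G] by (simp add: word_prod_def)
    then show ?case
      by (intro bexI[of _ \<one>]) (simp_all add: isometric_action_one[OF act])
  next
    case (Suc k)
    then obtain g where g: "g \<in> carrier G" "real k \<le> u \<bullet> (act g p - p)"
      "word_norm G S g \<le> m * k"
      by blast
    obtain t where t: "t \<in> T" "1 \<le> u \<bullet> (act (g \<otimes> t) p - act g p)"
      using step[OF g(1)] by blast
    have "t \<in> carrier G" using t T by blast
    then have "word_norm G S (g \<otimes> t) \<le> m * Suc k"
      using word_norm_mult[OF S g(1), of t] g(3) m[OF t(1)] by simp
    moreover have "real (Suc k) \<le> u \<bullet> (act (g \<otimes> t) p - p)"
      using g(2) t(2) by (simp add: inner_diff_right)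
    ultimately show ?case
      using g(1) \<open>t \<in> carrier G\<close> by blast
  qed
  moreover have "u \<bullet> (act g p - p) \<le> dist p (act g p)" for g
    using norm_cauchy_schwarz[of u "act g p - p"] u by (simp add: dist_norm norm_minus_commute)
  ultimately show ?thesis
    using that[of m] order_trans by meson
qed

section \<open>The upper limit\<close>

lemma le_limsup_if_frequently:
  fixes f :: "nat \<Rightarrow> 'a::complete_lattice"
  assumes "\<And>N. \<exists>j\<ge>N. c \<le> f j"
  shows "c \<le> limsup f"
  unfolding limsup_INF_SUP
proof (rule INF_greatest)
  fix N
  obtain j where "j \<ge> N" "c \<le> f j" using assms by blast
  then show "c \<le> (SUP m\<in>{N..}. f m)"
    by (intro SUP_upper2[of j]) auto
qed

theorem proposition6p2:
  fixes \<Gamma> :: "('g, 'b) monoid_scheme"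
    and S :: "'g set"
    and act :: "'g \<Rightarrow> real ^ 'n \<Rightarrow> real ^ 'n"
    and F :: "(real ^ 'n) set"
    and p :: "real ^ 'n"
  assumes "group \<Gamma>"
    and "finite S"
    and "symmetric_generating_set \<Gamma> S"
    and "isometric_action \<Gamma> act"
    and "bounded F"
    and "(\<Union>\<phi>\<in>carrier \<Gamma>. act \<phi> ` F) = UNIV"
  shows "limsup (\<lambda>k. ereal (Max {dist p (act \<phi> p) / real k | \<phi>.
           \<phi> \<in> carrier \<Gamma> \<and> word_norm \<Gamma> S \<phi> = k})) > 0"
proof -
  interpret group \<Gamma> by fact
  define C where "C = (\<Sum>s\<in>S. dist p (act s p))"
  have "C \<ge> 0" by (simp add: C_def sum_nonneg)
  have C: "dist p (act g p) \<le> C * real (word_norm \<Gamma> S g)" if "g \<in> carrier \<Gamma>" for g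
    unfolding C_def using displacement_le_word_norm assms that by blast
  obtain m where m: "\<And>k. \<exists>g\<in>carrier \<Gamma>. real k \<le> dist p (act g p) \<and> word_norm \<Gamma> S g \<le> m * k"
    using linear_displacement[OF assms(3-6)] by blast
  let ?D = "\<lambda>j. {dist p (act \<phi> p) / real j | \<phi>. \<phi> \<in> carrier \<Gamma> \<and> word_norm \<Gamma> S \<phi> = j}"
  have fin: "finite (?D j)" for j
    using finite_word_norm_sphere[OF assms(3,2), of j] by simp
  have "\<exists>j\<ge>N. ereal (1 / (real m + 1)) \<le> ereal (Max (?D j))" for N
  proof -
    \<comment> \<open>By the bound \<open>C\<close>, a displacement of at least this
      \<open>k\<close> forces a word norm beyond \<open>N\<close>.\<close>
    obtain k where k: "C * real N < real k"
      using reals_Archimedean2 by blast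
    obtain g where g: "g \<in> carrier \<Gamma>" "real k \<le> dist p (act g p)" "word_norm \<Gamma> S g \<le> m * k"
      using m by blast
    \<comment> \<open>The sphere of radius \<open>j\<close> contains \<open>g\<close>, so the value
      of \<open>Max\<close> on an empty set never enters.\<close>
    define j where "j = word_norm \<Gamma> S g"
    have "C * real N < C * real j"
      using k g(2) C[OF g(1)] by (simp add: j_def)
    then have "N < j"
      using \<open>C \<ge> 0\<close> by (simp add: mult_less_cancel_left)
    have "real j \<le> real m * real k"
      using g(3) unfolding j_def by (metis of_nat_le_iff of_nat_mult)
    \<comment> \<open>Passing to \<open>m + 1\<close> keeps the denominator positive even for
      \<open>m = 0\<close>; division by \<open>j\<close> is safe since \<open>N < j\<close>.\<close>
    also have "\<dots> \<le> (real m + 1) * dist p (act g p)"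
      using g(2) by (intro mult_mono) auto
    finally have "1 / (real m + 1) \<le> dist p (act g p) / real j"
      using \<open>N < j\<close> by (simp add: field_simps)
    also have "\<dots> \<le> Max (?D j)"
      using g(1) j_def by (intro Max_ge[OF fin]) blast
    finally show ?thesis
      using \<open>N < j\<close> by (intro exI[of _ j]) simp
  qed
  then have "ereal (1 / (real m + 1)) \<le> limsup (\<lambda>j. ereal (Max (?D j)))"
    by (rule le_limsup_if_frequently)
  moreover have "0 < ereal (1 / (real m + 1))"
    by simp
  ultimately show ?thesis
    by (rule less_le_trans[rotated])
qed

end
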